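(* Let $P$ be a finite poset with unique minimal element $\hat{0}$, let $\Bbbk$ be a field, and let $B(P)$ be the Betti poset of $P$ (over $\Bbbk$). For each $q\in B(P)$ and every $i$ there is an isomorphism of $\Bbbk$-vector spaces $\widetilde{H}_i(\Delta_q^{P},\Bbbk)\cong\widetilde{H}_i(\Delta_q^{B(P)},\Bbbk)$.
   Context: For a finite poset $Q$ with unique minimal element $\hat 0$ and $q\in Q$, $\Delta_q^{Q}$ denotes the order complex (simplicial complex of finite chains) of the open interval $(\hat 0,q)=\{x\in Q:\hat 0<x<q\}$ taken in $Q$. The order complex of an empty poset is the complex $\{\varnothing\}$, whose reduced homology is $\Bbbk$ in degree $-1$ and zero elsewhere; in particular this applies to $q=\hat 0$ and to $q$ an atom. $\widetilde H_i$ is reduced simplicial homology. The Betti poset of $P$ is the subposet $B(P)=\{q\in P : \widetilde H_i(\Delta_q^{P},\Bbbk)\neq 0 \text{ for at least one } i\}$ with the induced order; it contains $\hat 0$. *)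

theory Defs
  imports "Jordan_Normal_Form.VS_Connect" "HOL-Algebra.AbelCoset"
begin

text \<open>A finite poset is a finite subset of a partially ordered type; a subset of it carries the
  induced order. Simplices are finite vertex sets, and the empty simplex is a face of
  every order complex (it has dimension \<open>-1\<close>).\<close>

definition order_complex :: "'a::order set \<Rightarrow> 'a set set" where
  "order_complex X = {\<sigma>. \<sigma> \<subseteq> X \<and> finite \<sigma> \<and> Complete_Partial_Order.chain (\<le>) \<sigma>}"

definition interval_complex :: "'a::order set \<Rightarrow> 'a \<Rightarrow> 'a \<Rightarrow> 'a set set" where
  "interval_complex Q z q = order_complex {x \<in> Q. z < x \<and> x < q}"

text \<open>The chain \<open>c\<close> stands for the formal sum of \<open>c \<sigma> \<cdot> \<sigma>\<close> over the \<open>i\<close>-dimensional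
  simplices \<open>\<sigma>\<close> of \<open>K\<close>.\<close>

definition simplicial_chains :: "'a set set \<Rightarrow> int \<Rightarrow> ('a set \<Rightarrow> 'k::field) set" where
  "simplicial_chains K i =
     {c. finite {\<sigma>. c \<sigma> \<noteq> 0} \<and> (\<forall>\<sigma>. c \<sigma> \<noteq> 0 \<longrightarrow> \<sigma> \<in> K \<and> int (card \<sigma>) = i + 1)}"

definition chain_module :: "'a set set \<Rightarrow> int \<Rightarrow> ('k::field, 'a set \<Rightarrow> 'k) module" where
  "chain_module K i =
     \<lparr>carrier = simplicial_chains K i, mult = undefined, one = undefined,
      zero = (\<lambda>_. 0), add = (\<lambda>c d \<sigma>. c \<sigma> + d \<sigma>), smult = (\<lambda>a c \<sigma>. a * c \<sigma>)\<rparr>"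

text \<open>A simplex whose vertices are \<open>x\<^sub>0 < \<dots> < x\<^sub>n\<close> is oriented by this order, so that its
  boundary is the sum of \<open>(-1)^j (\<sigma> - {x\<^sub>j})\<close>, where \<open>j\<close> is the number of vertices of \<open>\<sigma>\<close>
  below \<open>x\<^sub>j\<close>. A single vertex is mapped to the empty simplex, so the complex is the augmented
  one and its homology is reduced homology. This requires every simplex to be totally ordered, as
  in an order complex.\<close>

definition simplex_boundary :: "'a::order set \<Rightarrow> 'a set \<Rightarrow> 'k::field" where
  "simplex_boundary \<sigma> =
     (\<lambda>\<tau>. \<Sum>x\<in>\<sigma>. if \<tau> = \<sigma> - {x} then (- 1) ^ card {y \<in> \<sigma>. y < x} else 0)"

definition boundary_map :: "('a::order set \<Rightarrow> 'k::field) \<Rightarrow> 'a set \<Rightarrow> 'k" where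
  "boundary_map c = (\<lambda>\<tau>. \<Sum>\<sigma> | c \<sigma> \<noteq> 0. c \<sigma> * simplex_boundary \<sigma> \<tau>)"

definition simplicial_cycles :: "'a::order set set \<Rightarrow> int \<Rightarrow> ('a set \<Rightarrow> 'k::field) set" where
  "simplicial_cycles K i = {c \<in> simplicial_chains K i. boundary_map c = (\<lambda>_. 0)}"

definition simplicial_boundaries :: "'a::order set set \<Rightarrow> int \<Rightarrow> ('a set \<Rightarrow> 'k::field) set" where
  "simplicial_boundaries K i = boundary_map ` simplicial_chains K (i + 1)"

definition quotient_module :: "('k, 'v) module \<Rightarrow> 'v set \<Rightarrow> ('k, 'v set) module" where
  "quotient_module V W =
     \<lparr>carrier = a_rcosets\<^bsub>V\<^esub> W, mult = undefined, one = undefined,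
      zero = W, add = (<+>\<^bsub>V\<^esub>), smult = (\<lambda>a X. \<Union>x\<in>X. W +>\<^bsub>V\<^esub> (a \<odot>\<^bsub>V\<^esub> x))\<rparr>"

definition reduced_homology ::
    "'a::order set set \<Rightarrow> int \<Rightarrow> ('k::field, ('a set \<Rightarrow> 'k) set) module" where
  "reduced_homology K i =
     quotient_module ((chain_module K i)\<lparr>carrier := simplicial_cycles K i\<rparr>)
       (simplicial_boundaries K i)"

definition vectorspace_isomorphic ::
    "'k ring \<Rightarrow> ('k, 'v) module \<Rightarrow> ('k, 'w) module \<Rightarrow> bool" where
  "vectorspace_isomorphic F V W \<longleftrightarrow>
     (\<exists>\<phi>. linear_map F V W \<phi> \<and> bij_betw \<phi> (carrier V) (carrier W))"

definition unique_minimal :: "'a::order set \<Rightarrow> 'a \<Rightarrow> bool" where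
  "unique_minimal P z \<longleftrightarrow> {x \<in> P. \<forall>y\<in>P. \<not> y < x} = {z}"

definition betti_poset :: "'k::field itself \<Rightarrow> 'a::order set \<Rightarrow> 'a \<Rightarrow> 'a set" where
  "betti_poset _ P z =
     {q \<in> P. \<exists>i. let H = (reduced_homology (interval_complex P z q) i
                           :: ('k, ('a set \<Rightarrow> 'k) set) module)
                 in carrier H \<noteq> {\<zero>\<^bsub>H\<^esub>}}"

end

theory Submission
  imports Defs
begin

text \<open>Put \<open>X = (z, q)\<close> in \<open>P\<close> and let \<open>Y\<close> be its set of Betti elements. The points of \<open>X - Y\<close> are
  removed one at a time, maximal ones first. When \<open>r\<close> is removed, everything below it is still
  present, so the simplices through \<open>r\<close> form the join of \<open>r\<close>, the acyclic complex of the open interval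
  \<open>(z, r)\<close> and the complex of the remaining points above \<open>r\<close>. Hence every chain whose boundary avoids
  \<open>r\<close> differs by a boundary from a chain that avoids \<open>r\<close>. Altogether a chain of \<open>X\<close> with boundary in
  \<open>Y\<close> is a chain of \<open>Y\<close> up to a boundary, which says that the relative homology of the pair vanishes:
  the cycles \<open>Z\<close> and boundaries \<open>B\<close> satisfy \<open>Z(X) = Z(Y) + B(X)\<close> and \<open>Z(Y) \<inter> B(X) = B(Y)\<close>.\<close>

section \<open>Quotient spaces\<close>

text \<open>Only closure under negatives needs an argument: they are multiples by \<open>-1\<close>.
  This gives access to the calculus of additive cosets.\<close>

lemma subspace_imp_abelian_subgroup:
  assumes "VectorSpace.subspace K W V"
  shows "abelian_subgroup W V"
proof -
  interpret V: vectorspace K V using assms by (rule subspace.vs)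
  interpret W: LinearCombinations.submodule K W V using assms by (rule subspace.submod)
  have "\<ominus>\<^bsub>V\<^esub> w \<in> W" if "w \<in> W" for w
  proof -
    have "(\<ominus>\<^bsub>K\<^esub> \<one>\<^bsub>K\<^esub>) \<odot>\<^bsub>V\<^esub> w \<in> W" using that by simp
    then show ?thesis using that W.subset V.smult_l_minus[of "\<one>\<^bsub>K\<^esub>" w]
      by (metis V.R.one_closed V.smult_one subsetD)
  qed
  then have "Group.subgroup W (add_monoid V)"
    using W.subset by (intro Group.subgroup.intro) (auto simp: a_inv_def)
  then show ?thesis
    by (intro abelian_subgroupI3 additive_subgroupI V.abelian_group_axioms)
qed

text \<open>Since \<open>a (w + x) = a w + a x\<close> and \<open>a w\<close> lies in
  \<open>W\<close>, all cosets in the union that defines the scalar multiple coincide. The set of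
  products alone would fail to be a coset for \<open>a = 0\<close> and \<open>W\<close>
  nonzero.\<close>

lemma quotient_module_smult_rcos:
  assumes "VectorSpace.subspace K W V" "a \<in> carrier K" "x \<in> carrier V"
  shows "a \<odot>\<^bsub>quotient_module V W\<^esub> (W +>\<^bsub>V\<^esub> x) = W +>\<^bsub>V\<^esub> (a \<odot>\<^bsub>V\<^esub> x)"
proof -
  interpret V: vectorspace K V using assms(1) by (rule subspace.vs)
  interpret W: LinearCombinations.submodule K W V using assms(1) by (rule subspace.submod)
  interpret G: abelian_subgroup W V using assms(1) by (rule subspace_imp_abelian_subgroup)
  have "W +>\<^bsub>V\<^esub> (a \<odot>\<^bsub>V\<^esub> y) = W +>\<^bsub>V\<^esub> (a \<odot>\<^bsub>V\<^esub> x)" if y: "y \<in> W +>\<^bsub>V\<^esub> x" for y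
  proof -
    obtain w where w: "w \<in> W" "y = w \<oplus>\<^bsub>V\<^esub> x" using y by (auto simp: a_r_coset_def')
    then have "a \<odot>\<^bsub>V\<^esub> y = a \<odot>\<^bsub>V\<^esub> w \<oplus>\<^bsub>V\<^esub> a \<odot>\<^bsub>V\<^esub> x"
      using assms(2,3) W.subset by (auto simp: V.smult_r_distr)
    then have "a \<odot>\<^bsub>V\<^esub> y \<in> W +>\<^bsub>V\<^esub> (a \<odot>\<^bsub>V\<^esub> x)"
      using assms(2) w by (auto simp: a_r_coset_def')
    then show ?thesis using G.a_repr_independence' assms(2,3) by simp
  qed
  moreover have "x \<in> W +>\<^bsub>V\<^esub> x" using assms(3) by (rule G.a_rcos_self)
  ultimately have "(\<Union>y\<in>W +>\<^bsub>V\<^esub> x. W +>\<^bsub>V\<^esub> (a \<odot>\<^bsub>V\<^esub> y)) = W +>\<^bsub>V\<^esub> (a \<odot>\<^bsub>V\<^esub> x)"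
    by blast
  then show ?thesis by (simp add: quotient_module_def)
qed

lemma carrier_quotient_module:
  "carrier (quotient_module V W) = (\<lambda>x. W +>\<^bsub>V\<^esub> x) ` carrier V"
  by (simp add: quotient_module_def A_RCOSETS_def RCOSETS_def a_r_coset_def UNION_singleton_eq_range)

text \<open>All operations can be computed on representatives, so each axiom reduces to the same
  axiom of \<open>V\<close>.\<close>

lemma vectorspace_quotient_module:
  assumes "VectorSpace.subspace K W V"
  shows "vectorspace K (quotient_module V W)"
proof -
  interpret V: vectorspace K V using assms by (rule subspace.vs)
  interpret G: abelian_subgroup W V using assms by (rule subspace_imp_abelian_subgroup)
  have add: "(W +>\<^bsub>V\<^esub> x) \<oplus>\<^bsub>quotient_module V W\<^esub> (W +>\<^bsub>V\<^esub> y) = W +>\<^bsub>V\<^esub> (x \<oplus>\<^bsub>V\<^esub> y)"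
    if "x \<in> carrier V" "y \<in> carrier V" for x y
    using G.a_rcos_sum that by (simp add: quotient_module_def)
  have zero: "\<zero>\<^bsub>quotient_module V W\<^esub> = W +>\<^bsub>V\<^esub> \<zero>\<^bsub>V\<^esub>"
    by (simp add: quotient_module_def G.a_rcos_const)
  have ag: "abelian_group (quotient_module V W)"
  proof (rule abelian_groupI)
    show "\<exists>Y\<in>carrier (quotient_module V W). Y \<oplus>\<^bsub>quotient_module V W\<^esub> X = \<zero>\<^bsub>quotient_module V W\<^esub>"
      if X: "X \<in> carrier (quotient_module V W)" for X
    proof -
      obtain x where x: "x \<in> carrier V" "X = W +>\<^bsub>V\<^esub> x" using X by (auto simp: carrier_quotient_module)
      then have "(W +>\<^bsub>V\<^esub> (\<ominus>\<^bsub>V\<^esub> x)) \<oplus>\<^bsub>quotient_module V W\<^esub> X = W +>\<^bsub>V\<^esub> \<zero>\<^bsub>V\<^esub>"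
        by (simp add: add V.l_neg)
      then show ?thesis using x by (auto simp: carrier_quotient_module zero)
    qed
  qed (simp_all add: carrier_quotient_module, auto simp: add zero V.a_ac)
  have "module K (quotient_module V W)"
  proof (rule moduleI)
    show "cring K" by (rule V.R.is_cring)
    show "abelian_group (quotient_module V W)" by (rule ag)
  qed (auto simp: carrier_quotient_module quotient_module_smult_rcos[OF assms] add
      V.smult_l_distr V.smult_r_distr V.smult_assoc1)
  then show ?thesis
    by (intro vectorspace.intro V.field_axioms)
qed

text \<open>In the second isomorphism theorem \<open>V / W \<cong> U / (U \<inter> W)\<close> with \<open>V = U + W\<close>, the coset
  \<open>S\<close> of \<open>W\<close> corresponds to the coset \<open>S \<inter> U\<close> of \<open>U \<inter> W\<close>.\<close>

lemma vectorspace_isomorphic_quotient_subspace: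
  assumes W: "VectorSpace.subspace K W V" and U: "VectorSpace.subspace K U V"
    and UW: "VectorSpace.subspace K (U \<inter> W) (V\<lparr>carrier := U\<rparr>)"
    and sum: "\<And>v. v \<in> carrier V \<Longrightarrow> \<exists>u\<in>U. u \<in> W +>\<^bsub>V\<^esub> v"
  shows "vectorspace_isomorphic K (quotient_module V W)
    (quotient_module (V\<lparr>carrier := U\<rparr>) (U \<inter> W))"
proof -
  interpret V: vectorspace K V using W by (rule subspace.vs)
  interpret G: abelian_subgroup W V using W by (rule subspace_imp_abelian_subgroup)
  interpret H: abelian_subgroup U V using U by (rule subspace_imp_abelian_subgroup)
  interpret U: LinearCombinations.submodule K U V using U by (rule subspace.submod)
  let ?U = "V\<lparr>carrier := U\<rparr>"
  let ?\<phi> = "\<lambda>S. S \<inter> U"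
  \<comment> \<open>If \<open>w + u\<close> and \<open>u\<close> lie in \<open>U\<close>, then so
    does \<open>w\<close>; hence intersecting with \<open>U\<close> shrinks \<open>W\<close> to
    \<open>U \<inter> W\<close> without changing the representative.\<close>
  have rep: "(W +>\<^bsub>V\<^esub> u) \<inter> U = (U \<inter> W) +>\<^bsub>?U\<^esub> u" if u: "u \<in> U" for u
  proof -
    have "w \<in> U" if "w \<in> W" "w \<oplus>\<^bsub>V\<^esub> u \<in> U" for w
    proof -
      have "w = (w \<oplus>\<^bsub>V\<^esub> u) \<oplus>\<^bsub>V\<^esub> (\<ominus>\<^bsub>V\<^esub> u)"
        using that u U.subset by (simp add: V.a_assoc V.r_neg subset_iff)
      also have "\<dots> \<in> U" using that u by blast
      finally show ?thesis .
    qed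
    then show ?thesis using u by (auto simp: a_r_coset_def')
  qed
  \<comment> \<open>By \<open>sum\<close> each coset of \<open>W\<close> has a representative in
    \<open>U\<close>; all computations below use such representatives.\<close>
  have cos: "\<exists>u\<in>U. S = W +>\<^bsub>V\<^esub> u" if S: "S \<in> carrier (quotient_module V W)" for S
  proof -
    obtain v where v: "v \<in> carrier V" "S = W +>\<^bsub>V\<^esub> v" using S by (auto simp: carrier_quotient_module)
    then obtain u where "u \<in> U" "u \<in> W +>\<^bsub>V\<^esub> v" using sum by blast
    then show ?thesis using v G.a_repr_independence' by blast
  qed
  have UV: "u \<in> carrier V" if "u \<in> U" for u using that U.subset by blast
  interpret GU: abelian_subgroup "U \<inter> W" ?U using UW by (rule subspace_imp_abelian_subgroup)
  have addU: "((U \<inter> W) +>\<^bsub>?U\<^esub> x) \<oplus>\<^bsub>quotient_module ?U (U \<inter> W)\<^esub> ((U \<inter> W) +>\<^bsub>?U\<^esub> y)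
      = (U \<inter> W) +>\<^bsub>?U\<^esub> (x \<oplus>\<^bsub>V\<^esub> y)" if "x \<in> U" "y \<in> U" for x y
    using GU.a_rcos_sum[of x y] that by (simp add: quotient_module_def)
  have addV: "(W +>\<^bsub>V\<^esub> x) \<oplus>\<^bsub>quotient_module V W\<^esub> (W +>\<^bsub>V\<^esub> y) = W +>\<^bsub>V\<^esub> (x \<oplus>\<^bsub>V\<^esub> y)"
    if "x \<in> U" "y \<in> U" for x y
    using G.a_rcos_sum that UV by (simp add: quotient_module_def)
  have hom: "?\<phi> \<in> LinearCombinations.module_hom K (quotient_module V W) (quotient_module ?U (U \<inter> W))"
    unfolding LinearCombinations.module_hom_def
  proof (intro CollectI conjI allI impI funcsetI)
    fix S assume "S \<in> carrier (quotient_module V W)"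
    then obtain u where "u \<in> U" "S = W +>\<^bsub>V\<^esub> u" using cos by blast
    then show "S \<inter> U \<in> carrier (quotient_module ?U (U \<inter> W))"
      by (auto simp: rep carrier_quotient_module)
  next
    fix S T assume "S \<in> carrier (quotient_module V W) \<and> T \<in> carrier (quotient_module V W)"
    then obtain u t where "u \<in> U" "S = W +>\<^bsub>V\<^esub> u" "t \<in> U" "T = W +>\<^bsub>V\<^esub> t" using cos by meson
    then show "(S \<oplus>\<^bsub>quotient_module V W\<^esub> T) \<inter> U
        = (S \<inter> U) \<oplus>\<^bsub>quotient_module ?U (U \<inter> W)\<^esub> (T \<inter> U)"
      by (simp add: rep addU addV)
  next
    fix a S assume "a \<in> carrier K \<and> S \<in> carrier (quotient_module V W)"
    moreover from this obtain u where "u \<in> U" "S = W +>\<^bsub>V\<^esub> u" using cos by blast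
    ultimately show "(a \<odot>\<^bsub>quotient_module V W\<^esub> S) \<inter> U
        = a \<odot>\<^bsub>quotient_module ?U (U \<inter> W)\<^esub> (S \<inter> U)"
      using quotient_module_smult_rcos[OF UW, of a u]
      by (simp add: rep UV quotient_module_smult_rcos[OF W])
  qed
  then have "linear_map K (quotient_module V W) (quotient_module ?U (U \<inter> W)) ?\<phi>"
    using vectorspace_quotient_module[OF W] vectorspace_quotient_module[OF UW]
    by (auto intro!: linear_map.intro mod_hom.intro mod_hom_axioms.intro simp: vectorspace_def)
  moreover have "bij_betw ?\<phi> (carrier (quotient_module V W)) (carrier (quotient_module ?U (U \<inter> W)))"
    unfolding bij_betw_def
  proof
    show "inj_on ?\<phi> (carrier (quotient_module V W))"
    proof (rule inj_onI)
      fix S T assume ST: "S \<in> carrier (quotient_module V W)" "T \<in> carrier (quotient_module V W)"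
        "S \<inter> U = T \<inter> U"
      obtain u t where u: "u \<in> U" "S = W +>\<^bsub>V\<^esub> u" "t \<in> U" "T = W +>\<^bsub>V\<^esub> t" using cos ST by meson
      \<comment> \<open>Cosets of \<open>W\<close> that share a point are equal, and
        \<open>u\<close> is such a point.\<close>
      then have "u \<in> T" using ST(3) G.a_rcos_self[of u] UV by blast
      then show "S = T" using G.a_repr_independence'[of u t] u UV by simp
    qed
    show "?\<phi> ` carrier (quotient_module V W) = carrier (quotient_module ?U (U \<inter> W))"
    proof
      show "?\<phi> ` carrier (quotient_module V W) \<subseteq> carrier (quotient_module ?U (U \<inter> W))"
        using LinearCombinations.module_hom_closed[OF hom] by blast
      show "carrier (quotient_module ?U (U \<inter> W)) \<subseteq> ?\<phi> ` carrier (quotient_module V W)"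
      proof
        fix S assume "S \<in> carrier (quotient_module ?U (U \<inter> W))"
        then obtain u where u: "u \<in> U" "S = (U \<inter> W) +>\<^bsub>?U\<^esub> u"
          by (auto simp: carrier_quotient_module)
        moreover have "W +>\<^bsub>V\<^esub> u \<in> carrier (quotient_module V W)"
          unfolding carrier_quotient_module using UV[OF u(1)] by (rule imageI)
        ultimately show "S \<in> ?\<phi> ` carrier (quotient_module V W)"
          using rep by (intro image_eqI) simp_all
      qed
    qed
  qed
  ultimately show ?thesis unfolding vectorspace_isomorphic_def by blast
qed

section \<open>Chains of order complexes\<close>

lemma subset_order_complex: "\<sigma> \<in> order_complex X \<Longrightarrow> \<tau> \<subseteq> \<sigma> \<Longrightarrow> \<tau> \<in> order_complex X"
  by (auto simp: order_complex_def intro: finite_subset Complete_Partial_Order.chain_subset)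

lemma order_complex_mono: "Y \<subseteq> X \<Longrightarrow> order_complex Y \<subseteq> order_complex X"
  by (auto simp: order_complex_def)

lemma order_complex_comparable:
  "\<sigma> \<in> order_complex X \<Longrightarrow> x \<in> \<sigma> \<Longrightarrow> y \<in> \<sigma> \<Longrightarrow> x \<le> y \<or> y \<le> x"
  by (auto simp: order_complex_def Complete_Partial_Order.chain_def)

text \<open>A finite vertex set has only finitely many simplices, so the finiteness of the support
  is automatic.\<close>

lemma chains_order_complex_iff:
  assumes "finite X"
  shows "c \<in> simplicial_chains (order_complex X) i
    \<longleftrightarrow> (\<forall>\<sigma>. c \<sigma> \<noteq> 0 \<longrightarrow> \<sigma> \<in> order_complex X \<and> int (card \<sigma>) = i + 1)"
proof -
  have "finite (order_complex X)"
    using assms by (rule finite_subset[rotated, OF finite_Pow_iff[THEN iffD2]])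
      (auto simp: order_complex_def)
  then have "finite {\<sigma>. c \<sigma> \<noteq> 0}" if "\<forall>\<sigma>. c \<sigma> \<noteq> 0 \<longrightarrow> \<sigma> \<in> order_complex X \<and> int (card \<sigma>) = i + 1"
    by (rule finite_subset[rotated]) (use that in blast)
  then show ?thesis by (auto simp: simplicial_chains_def)
qed

section \<open>Linear operations on chains\<close>

lemma chains_zero [simp]: "(\<lambda>_. 0) \<in> simplicial_chains K i"
  by (simp add: simplicial_chains_def)

lemma chains_add:
  assumes "c \<in> simplicial_chains K i" "d \<in> simplicial_chains K i"
  shows "(\<lambda>\<sigma>. c \<sigma> + d \<sigma>) \<in> simplicial_chains K i"
proof -
  have "finite ({\<sigma>. c \<sigma> \<noteq> 0} \<union> {\<sigma>. d \<sigma> \<noteq> 0})"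
    using assms by (simp add: simplicial_chains_def)
  then have "finite {\<sigma>. c \<sigma> + d \<sigma> \<noteq> 0}"
    by (rule finite_subset[rotated]) auto
  moreover have "c \<sigma> \<noteq> 0 \<or> d \<sigma> \<noteq> 0" if "c \<sigma> + d \<sigma> \<noteq> 0" for \<sigma> using that by auto
  ultimately show ?thesis
    using assms unfolding simplicial_chains_def by blast
qed

lemma chains_smult:
  assumes "c \<in> simplicial_chains K i"
  shows "(\<lambda>\<sigma>. a * c \<sigma>) \<in> simplicial_chains K i"
proof -
  have "finite {\<sigma>. c \<sigma> \<noteq> 0}"
    using assms by (simp add: simplicial_chains_def)
  then have "finite {\<sigma>. a * c \<sigma> \<noteq> 0}"
    by (rule finite_subset[rotated]) auto
  then show ?thesis
    using assms by (simp add: simplicial_chains_def)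
qed

lemma chains_diff:
  assumes "c \<in> simplicial_chains K i" "d \<in> simplicial_chains K i"
  shows "(\<lambda>\<sigma>. c \<sigma> - d \<sigma>) \<in> simplicial_chains K i"
  using chains_add[OF assms(1) chains_smult[OF assms(2), of "-1"]] by simp

lemma chains_mono: "K \<subseteq> L \<Longrightarrow> simplicial_chains K i \<subseteq> simplicial_chains L i"
  by (auto simp: simplicial_chains_def)

text \<open>Order complexes are full: whether a vertex set is a simplex depends only on the order
  among its own vertices.\<close>

lemma chains_restrict:
  assumes "c \<in> simplicial_chains (order_complex X) i" "\<And>\<sigma>. c \<sigma> \<noteq> 0 \<Longrightarrow> \<sigma> \<subseteq> Y"
  shows "c \<in> simplicial_chains (order_complex Y) i"
  using assms by (auto simp: simplicial_chains_def order_complex_def)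

section \<open>The boundary operator of a finite order complex\<close>

text \<open>The simplices with \<open>\<tau>\<close> as a facet are the sets
  \<open>insert x \<tau>\<close> with \<open>x \<notin> \<tau>\<close>, and \<open>x\<close> does
  not count itself in the sign. The index set no longer depends on \<open>c\<close>, which makes
  linearity immediate.\<close>

lemma boundary_map_eq:
  fixes c :: "'a::order set \<Rightarrow> 'k::field"
  assumes "finite X" "c \<in> simplicial_chains (order_complex X) i"
  shows "boundary_map c \<tau> = (\<Sum>x\<in>X - \<tau>. (- 1) ^ card {y \<in> \<tau>. y < x} * c (insert x \<tau>))"
proof -
  have supp: "\<sigma> \<subseteq> X" if "c \<sigma> \<noteq> 0" for \<sigma>
    using that assms by (auto simp: simplicial_chains_def order_complex_def)
  \<comment> \<open>Written with a guard, the summand can range over all of \<open>Pow X\<close> and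
    \<open>X\<close>, so the two sums can be interchanged.\<close>
  let ?f = "\<lambda>\<sigma> x. if x \<in> \<sigma> \<and> \<tau> = \<sigma> - {x} then c \<sigma> * (- 1) ^ card {y \<in> \<sigma>. y < x} else 0"
  have "boundary_map c \<tau> = (\<Sum>\<sigma>\<in>Pow X. c \<sigma> * simplex_boundary \<sigma> \<tau>)"
    unfolding boundary_map_def using assms(1) supp by (intro sum.mono_neutral_left) auto
  also have "\<dots> = (\<Sum>\<sigma>\<in>Pow X. \<Sum>x\<in>X. ?f \<sigma> x)"
  proof (rule sum.cong[OF refl])
    fix \<sigma> assume "\<sigma> \<in> Pow X"
    then have \<sigma>: "\<sigma> \<subseteq> X" by simp
    have "c \<sigma> * simplex_boundary \<sigma> \<tau> = (\<Sum>x\<in>\<sigma>. ?f \<sigma> x)"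
      unfolding simplex_boundary_def sum_distrib_left by (intro sum.cong) auto
    also have "\<dots> = (\<Sum>x\<in>X. ?f \<sigma> x)"
      using assms(1) \<sigma> by (intro sum.mono_neutral_left) auto
    finally show "c \<sigma> * simplex_boundary \<sigma> \<tau> = (\<Sum>x\<in>X. ?f \<sigma> x)" .
  qed
  also have "\<dots> = (\<Sum>x\<in>X. \<Sum>\<sigma>\<in>Pow X. ?f \<sigma> x)" by (rule sum.swap)
  also have "\<dots> = (\<Sum>x\<in>X. if x \<in> \<tau> then 0 else (- 1) ^ card {y \<in> \<tau>. y < x} * c (insert x \<tau>))"
  proof (rule sum.cong[OF refl])
    fix x assume "x \<in> X"
    have eq: "x \<in> \<sigma> \<and> \<tau> = \<sigma> - {x} \<longleftrightarrow> \<sigma> = insert x \<tau> \<and> x \<notin> \<tau>" for \<sigma> by auto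
    have card: "{y. (y = x \<or> y \<in> \<tau>) \<and> y < x} = {y \<in> \<tau>. y < x}" by auto
    have "(\<Sum>\<sigma>\<in>Pow X. ?f \<sigma> x) = (\<Sum>\<sigma>\<in>Pow X. if \<sigma> = insert x \<tau> then
        (if x \<in> \<tau> then 0 else (- 1) ^ card {y \<in> \<tau>. y < x} * c (insert x \<tau>)) else 0)"
      unfolding eq by (intro sum.cong) (auto simp: card)
    \<comment> \<open>If \<open>insert x \<tau>\<close> is not a subset of \<open>X\<close>, it is
      missing from the sum, but then its coefficient is zero by \<open>supp\<close>.\<close>
    also have "\<dots> = (if x \<in> \<tau> then 0 else (- 1) ^ card {y \<in> \<tau>. y < x} * c (insert x \<tau>))"
      using assms(1) supp[of "insert x \<tau>"] by auto
    finally show "(\<Sum>\<sigma>\<in>Pow X. ?f \<sigma> x)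
        = (if x \<in> \<tau> then 0 else (- 1) ^ card {y \<in> \<tau>. y < x} * c (insert x \<tau>))" .
  qed
  also have "\<dots> = (\<Sum>x\<in>X - \<tau>. (- 1) ^ card {y \<in> \<tau>. y < x} * c (insert x \<tau>))"
    using assms(1) by (intro sum.mono_neutral_cong_right) auto
  finally show ?thesis .
qed

lemma boundary_map_zero: "boundary_map (\<lambda>_. 0) = (\<lambda>_. 0)"
  by (simp add: boundary_map_def)

lemma boundary_map_add:
  fixes c d :: "'a::order set \<Rightarrow> 'k::field"
  assumes "finite X" "c \<in> simplicial_chains (order_complex X) i"
    "d \<in> simplicial_chains (order_complex X) i"
  shows "boundary_map (\<lambda>\<sigma>. c \<sigma> + d \<sigma>) = (\<lambda>\<tau>. boundary_map c \<tau> + boundary_map d \<tau>)"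
  by (rule ext)
    (simp add: boundary_map_eq[OF assms(1) assms(2)] boundary_map_eq[OF assms(1) assms(3)]
      boundary_map_eq[OF assms(1) chains_add[OF assms(2,3)]] distrib_left sum.distrib)

lemma boundary_map_smult:
  fixes c :: "'a::order set \<Rightarrow> 'k::field"
  assumes "finite X" "c \<in> simplicial_chains (order_complex X) i"
  shows "boundary_map (\<lambda>\<sigma>. a * c \<sigma>) = (\<lambda>\<tau>. a * boundary_map c \<tau>)"
  by (rule ext)
    (simp add: boundary_map_eq[OF assms] boundary_map_eq[OF assms(1) chains_smult[OF assms(2)]]
      sum_distrib_left mult.left_commute)

lemma boundary_map_diff:
  fixes c d :: "'a::order set \<Rightarrow> 'k::field"
  assumes "finite X" "c \<in> simplicial_chains (order_complex X) i"
    "d \<in> simplicial_chains (order_complex X) i"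
  shows "boundary_map (\<lambda>\<sigma>. c \<sigma> - d \<sigma>) = (\<lambda>\<tau>. boundary_map c \<tau> - boundary_map d \<tau>)"
  using boundary_map_add[OF assms(1,2) chains_smult[OF assms(3), of "-1"]]
    boundary_map_smult[OF assms(1,3), of "-1"] by simp

lemma boundary_map_chains:
  fixes c :: "'a::order set \<Rightarrow> 'k::field"
  assumes X: "finite X" and c: "c \<in> simplicial_chains (order_complex X) i"
  shows "boundary_map c \<in> simplicial_chains (order_complex X) (i - 1)"
  unfolding chains_order_complex_iff[OF X]
proof (intro allI impI)
  fix \<tau> assume "boundary_map c \<tau> \<noteq> 0"
  then obtain x where x: "x \<in> X - \<tau>" "c (insert x \<tau>) \<noteq> 0"
    unfolding boundary_map_eq[OF assms] by (metis (no_types, lifting) mult_zero_right sum.neutral)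
  then have *: "insert x \<tau> \<in> order_complex X" "int (card (insert x \<tau>)) = i + 1"
    using c by (auto simp: simplicial_chains_def)
  then have "finite \<tau>" by (auto simp: order_complex_def)
  then show "\<tau> \<in> order_complex X \<and> int (card \<tau>) = i - 1 + 1"
    using * x subset_order_complex[of _ X \<tau>] by auto
qed

text \<open>Two vertices can be added to \<open>\<tau>\<close> in two orders, and the two terms have
  opposite signs.\<close>

lemma boundary_map_boundary_map:
  fixes c :: "'a::order set \<Rightarrow> 'k::field"
  assumes X: "finite X" and c: "c \<in> simplicial_chains (order_complex X) i"
  shows "boundary_map (boundary_map c) = (\<lambda>_. 0)"
proof
  fix \<tau>
  show "boundary_map (boundary_map c) \<tau> = 0"
  proof (cases "finite \<tau>")
    \<comment> \<open>The sign argument needs true cardinalities, whereas \<open>card\<close> is 0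
      on infinite sets; an infinite \<open>\<tau>\<close> is no simplex, so its coefficient is zero
      anyway.\<close>
    case False
    have "\<tau> \<notin> order_complex X" using False by (simp add: order_complex_def)
    then show ?thesis
      using boundary_map_chains[OF X boundary_map_chains[OF X c]]
      by (auto simp: simplicial_chains_def)
  next
    case fin: True
    let ?s = "\<lambda>\<tau> x. (- 1 :: 'k) ^ card {y \<in> \<tau>. y < x}"
    let ?N = "X - \<tau>"
    define f where "f x y = ?s \<tau> x * (?s (insert x \<tau>) y * c (insert y (insert x \<tau>)))" for x y
    \<comment> \<open>The smaller vertex \<open>x\<close> is counted in the sign of \<open>y\<close>
      if it was added before; \<open>y\<close> is never counted in the sign of
      \<open>x\<close>.\<close>
    have swap: "f y x = - f x y" if "x < y" "x \<in> ?N" for x y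
    proof -
      have "{z \<in> insert x \<tau>. z < y} = insert x {z \<in> \<tau>. z < y}" "{z \<in> insert y \<tau>. z < x} = {z \<in> \<tau>. z < x}"
        using that by auto
      moreover have "card (insert x {z \<in> \<tau>. z < y}) = Suc (card {z \<in> \<tau>. z < y})"
        using that fin by simp
      ultimately show ?thesis
        by (simp add: f_def insert_commute)
    qed
    \<comment> \<open>The order is only partial, but two incomparable vertices never occur in one
      simplex.\<close>
    have incomparable: "f x y = 0" if "\<not> x < y" "\<not> y < x" "x \<noteq> y" for x y
    proof -
      have "insert y (insert x \<tau>) \<notin> order_complex X"
        using that order_complex_comparable[of _ X x y] by (auto simp: less_le)
      then have "c (insert y (insert x \<tau>)) = 0" using c by (auto simp: simplicial_chains_def)
      then show ?thesis by (simp add: f_def)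
    qed
    have finN: "finite ?N" using X by simp
    have "boundary_map (boundary_map c) \<tau> = (\<Sum>x\<in>?N. \<Sum>y\<in>?N - {x}. f x y)"
      unfolding boundary_map_eq[OF X boundary_map_chains[OF X c]] boundary_map_eq[OF X c]
      unfolding f_def sum_distrib_left by (intro sum.cong) auto
    also have "\<dots> = (\<Sum>x\<in>?N. (\<Sum>y\<in>?N. if x < y then f x y else 0)
        + (\<Sum>y\<in>?N. if y < x then f x y else 0))"
    proof (rule sum.cong[OF refl])
      fix x assume "x \<in> ?N"
      have "(\<Sum>y\<in>?N - {x}. f x y)
          = (\<Sum>y\<in>?N. (if x < y then f x y else 0) + (if y < x then f x y else 0))"
        using finN incomparable by (intro sum.mono_neutral_cong_left) auto
      then show "(\<Sum>y\<in>?N - {x}. f x y) = (\<Sum>y\<in>?N. if x < y then f x y else 0)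
        + (\<Sum>y\<in>?N. if y < x then f x y else 0)" by (simp add: sum.distrib)
    qed
    also have "\<dots> = (\<Sum>x\<in>?N. \<Sum>y\<in>?N. if x < y then f x y else 0)
        + (\<Sum>x\<in>?N. \<Sum>y\<in>?N. if y < x then f x y else 0)"
      by (rule sum.distrib)
    also have "(\<Sum>x\<in>?N. \<Sum>y\<in>?N. if y < x then f x y else 0)
        = (\<Sum>y\<in>?N. \<Sum>x\<in>?N. if y < x then f x y else 0)" by (rule sum.swap)
    also have "\<dots> = (\<Sum>y\<in>?N. \<Sum>x\<in>?N. - (if y < x then f y x else 0))"
      using swap by (intro sum.cong) auto
    also have "\<dots> = - (\<Sum>x\<in>?N. \<Sum>y\<in>?N. if x < y then f x y else 0)"
      by (simp add: sum_negf)
    finally show ?thesis by simp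
  qed
qed

section \<open>Decomposing the simplices through a point\<close>

text \<open>The component of \<open>f\<close> at \<open>\<gamma>\<close> in a join decomposition:
  the coefficients of simplices made of \<open>\<gamma>\<close> and a part in \<open>A\<close>, read
  as a chain on \<open>A\<close>. The guard keeps the support inside \<open>A\<close>.\<close>

definition slice :: "'a::order set \<Rightarrow> 'a set \<Rightarrow> ('a set \<Rightarrow> 'k::field) \<Rightarrow> 'a set \<Rightarrow> 'k" where
  "slice A \<gamma> f \<alpha> = (if \<alpha> \<subseteq> A then f (\<alpha> \<union> \<gamma>) else 0)"

text \<open>Removing the vertices of \<open>\<gamma>\<close> from a simplex lowers its dimension by
  \<open>card \<gamma>\<close>; disjointness ensures that none is counted twice.\<close>

lemma slice_chains:
  fixes f :: "'a::order set \<Rightarrow> 'k::field"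
  assumes X: "finite X" and f: "f \<in> simplicial_chains (order_complex X) j"
    and A: "A \<subseteq> X" and \<gamma>: "finite \<gamma>" "A \<inter> \<gamma> = {}"
  shows "slice A \<gamma> f \<in> simplicial_chains (order_complex A) (j - int (card \<gamma>))"
proof -
  have A': "finite A" using A X by (rule finite_subset)
  show ?thesis
    unfolding chains_order_complex_iff[OF A']
  proof (intro allI impI)
    fix \<alpha> assume "slice A \<gamma> f \<alpha> \<noteq> 0"
    then have \<alpha>: "\<alpha> \<subseteq> A" "f (\<alpha> \<union> \<gamma>) \<noteq> 0" by (auto simp: slice_def split: if_splits)
    then have *: "\<alpha> \<union> \<gamma> \<in> order_complex X" "int (card (\<alpha> \<union> \<gamma>)) = j + 1"
      using f by (auto simp: simplicial_chains_def)
    have "\<alpha> \<in> order_complex X" using subset_order_complex[OF *(1)] by simp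
    then have "\<alpha> \<in> order_complex A" using \<alpha> by (simp add: order_complex_def)
    moreover have "card (\<alpha> \<union> \<gamma>) = card \<alpha> + card \<gamma>"
      using \<alpha> \<gamma> A' by (intro card_Un_disjoint) (auto intro: finite_subset)
    ultimately show "\<alpha> \<in> order_complex A \<and> int (card \<alpha>) = j - int (card \<gamma>) + 1"
      using * by simp
  qed
qed

text \<open>A vertex \<open>x\<close> added to \<open>\<alpha> \<union> insert r \<beta>\<close>
  contributes only if \<open>x < r\<close>: above \<open>r\<close> it makes more than
  \<open>n\<close> upper vertices, where \<open>f\<close> vanishes, and a point incomparable to
  \<open>r\<close> yields no simplex. For \<open>x < r\<close> the sign counts only vertices of
  \<open>\<alpha>\<close>, since \<open>r\<close> and \<open>\<beta>\<close> lie above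
  \<open>x\<close>.\<close>

lemma boundary_map_slice:
  fixes f :: "'a::order set \<Rightarrow> 'k::field"
  assumes X: "finite X" and r: "r \<in> X"
    and f: "f \<in> simplicial_chains (order_complex X) j"
    and vanish: "\<And>\<sigma>. r \<in> \<sigma> \<Longrightarrow> n < card {y \<in> \<sigma>. r < y} \<Longrightarrow> f \<sigma> = 0"
    and \<beta>: "\<beta> \<subseteq> {x \<in> X. r < x}" "card \<beta> = n"
    and \<alpha>: "\<alpha> \<subseteq> {x \<in> X. x < r}"
  shows "boundary_map (slice {x \<in> X. x < r} (insert r \<beta>) f) \<alpha> = boundary_map f (\<alpha> \<union> insert r \<beta>)"
proof -
  let ?A = "{x \<in> X. x < r}" and ?\<sigma> = "\<alpha> \<union> insert r \<beta>"
  have fin: "finite \<beta>" using \<beta> X by (auto intro: finite_subset)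
  have A: "finite ?A" "?A \<subseteq> X" using X by auto
  have disj: "?A \<inter> insert r \<beta> = {}" using \<beta> by auto
  have sl: "slice ?A (insert r \<beta>) f \<in> simplicial_chains (order_complex ?A) (j - int (card (insert r \<beta>)))"
    using slice_chains[OF X f A(2) _ disj] fin by simp
  have zero: "f (insert x ?\<sigma>) = 0" if x: "x \<in> X - ?\<sigma>" "\<not> x < r" for x
  proof (cases "r < x")
    case True
    have "{y \<in> insert x ?\<sigma>. r < y} = insert x \<beta>" using True \<alpha> \<beta> by auto
    then show ?thesis using x fin \<beta> by (intro vanish) auto
  next
    case False
    then have "insert x ?\<sigma> \<notin> order_complex X"
      using x order_complex_comparable[of _ X x r] by (auto simp: less_le)
    then show ?thesis using f by (auto simp: simplicial_chains_def)
  qed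
  have "boundary_map f ?\<sigma> = (\<Sum>x\<in>X - ?\<sigma>. (- 1) ^ card {y \<in> ?\<sigma>. y < x} * f (insert x ?\<sigma>))"
    by (rule boundary_map_eq[OF X f])
  also have "\<dots> = (\<Sum>x\<in>?A - \<alpha>. (- 1) ^ card {y \<in> ?\<sigma>. y < x} * f (insert x ?\<sigma>))"
    using X zero \<beta> by (intro sum.mono_neutral_right) auto
  also have "\<dots> = (\<Sum>x\<in>?A - \<alpha>. (- 1) ^ card {y \<in> \<alpha>. y < x} * slice ?A (insert r \<beta>) f (insert x \<alpha>))"
  proof (rule sum.cong[OF refl])
    fix x assume x: "x \<in> ?A - \<alpha>"
    then have "{y \<in> ?\<sigma>. y < x} = {y \<in> \<alpha>. y < x}" using \<beta> by auto
    then show "(- 1) ^ card {y \<in> ?\<sigma>. y < x} * f (insert x ?\<sigma>)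
      = (- 1) ^ card {y \<in> \<alpha>. y < x} * slice ?A (insert r \<beta>) f (insert x \<alpha>)"
      using x \<alpha> by (simp add: slice_def insert_commute)
  qed
  also have "\<dots> = boundary_map (slice ?A (insert r \<beta>) f) \<alpha>"
    by (rule boundary_map_eq[OF A(1) sl, symmetric])
  finally show ?thesis by simp
qed

section \<open>Removing points with acyclic lower interval\<close>

text \<open>A chain is pushed off \<open>r\<close> by descending induction on \<open>n\<close>, a bound for the number of vertices
  above \<open>r\<close> in the simplices through \<open>r\<close>: for those simplices where this number is maximal, the
  part below \<open>r\<close> is a cycle, hence a boundary.\<close>

lemma relative_cycle_remove_point_aux:
  fixes c :: "'a::order set \<Rightarrow> 'k::field"
  assumes X: "finite X" and r: "r \<in> X"
    and acyclic: "\<And>j. (simplicial_cycles (order_complex {x \<in> X. x < r}) j :: ('a set \<Rightarrow> 'k) set)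
      \<subseteq> simplicial_boundaries (order_complex {x \<in> X. x < r}) j"
    and "c \<in> simplicial_chains (order_complex X) i"
    and "\<And>\<tau>. r \<in> \<tau> \<Longrightarrow> boundary_map c \<tau> = 0"
    and "\<And>\<sigma>. r \<in> \<sigma> \<Longrightarrow> n \<le> card {y \<in> \<sigma>. r < y} \<Longrightarrow> c \<sigma> = 0"
  shows "\<exists>e\<in>simplicial_chains (order_complex X) (i + 1). \<forall>\<sigma>. r \<in> \<sigma> \<longrightarrow> c \<sigma> = boundary_map e \<sigma>"
  using assms(4-6)
proof (induction n arbitrary: c)
  case 0
  \<comment> \<open>The bound 0 says that \<open>c\<close> already vanishes on every simplex through
    \<open>r\<close>.\<close>
  then show ?case by (intro bexI[of _ "\<lambda>_. 0"]) (auto simp: boundary_map_zero)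
next
  case (Suc n)
  note c = Suc.prems(1) and cyc = Suc.prems(2) and vanish = Suc.prems(3)
  let ?A = "{x \<in> X. x < r}"
  \<comment> \<open>The possible upper parts of the simplices through \<open>r\<close> with the top
    number \<open>n\<close> of vertices above \<open>r\<close>.\<close>
  let ?G = "{\<beta>. \<beta> \<subseteq> {x \<in> X. r < x} \<and> \<beta> \<in> order_complex X \<and> card \<beta> = n}"
  have A: "finite ?A" "?A \<subseteq> X" using X by auto
  have G: "finite (insert r \<beta>)" "?A \<inter> insert r \<beta> = {}" "card (insert r \<beta>) = Suc n" if "\<beta> \<in> ?G" for \<beta>
  proof -
    have "finite \<beta>" "r \<notin> \<beta>" using that by (auto simp: order_complex_def)
    then show "finite (insert r \<beta>)" "?A \<inter> insert r \<beta> = {}" "card (insert r \<beta>) = Suc n"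
      using that by auto
  qed
  \<comment> \<open>The boundary of the slice is a coefficient of the boundary of \<open>c\<close>
    at a simplex through \<open>r\<close>, hence zero. Splitting off \<open>r\<close> and
    \<open>\<beta>\<close> costs \<open>n + 1\<close> dimensions, so the slice has degree
    \<open>i - n - 1\<close> and a primitive has degree \<open>i - n\<close>.\<close>
  have "\<forall>\<beta>\<in>?G. \<exists>d. d \<in> simplicial_chains (order_complex ?A) (i - int n)
      \<and> boundary_map d = slice ?A (insert r \<beta>) c"
  proof
    fix \<beta> assume \<beta>: "\<beta> \<in> ?G"
    let ?c = "slice ?A (insert r \<beta>) c"
    have ch: "?c \<in> simplicial_chains (order_complex ?A) (i - int n - 1)"
      using slice_chains[OF X c A(2) G(1,2)[OF \<beta>]] G(3)[OF \<beta>] by (simp add: algebra_simps)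
    have "boundary_map ?c \<alpha> = 0" for \<alpha>
    proof (cases "\<alpha> \<subseteq> ?A")
      case True
      have "boundary_map ?c \<alpha> = boundary_map c (\<alpha> \<union> insert r \<beta>)"
        using \<beta> True by (intro boundary_map_slice[OF X r c vanish]) auto
      then show ?thesis using cyc by simp
    next
      case False
      then have "\<alpha> \<notin> order_complex ?A" by (auto simp: order_complex_def)
      then show ?thesis
        using boundary_map_chains[OF A(1) ch] by (auto simp: simplicial_chains_def)
    qed
    then have "?c \<in> simplicial_cycles (order_complex ?A) (i - int n - 1)"
      using ch by (auto simp: simplicial_cycles_def)
    then have "?c \<in> simplicial_boundaries (order_complex ?A) (i - int n - 1)"
      using acyclic by blast
    then show "\<exists>d. d \<in> simplicial_chains (order_complex ?A) (i - int n) \<and> boundary_map d = ?c"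
      by (auto simp: simplicial_boundaries_def)
  qed
  from bchoice[OF this] obtain d where d: "\<And>\<beta>. \<beta> \<in> ?G \<Longrightarrow> d \<beta> \<in> simplicial_chains (order_complex ?A) (i - int n)"
      "\<And>\<beta>. \<beta> \<in> ?G \<Longrightarrow> boundary_map (d \<beta>) = slice ?A (insert r \<beta>) c"
    by blast
  define e where "e \<sigma> = (if \<sigma> \<in> order_complex X \<and> r \<in> \<sigma> \<and> card {y \<in> \<sigma>. r < y} = n
    then d {y \<in> \<sigma>. r < y} {y \<in> \<sigma>. y < r} else 0)" for \<sigma>
  have split: "{y \<in> \<sigma>. y < r} \<union> insert r {y \<in> \<sigma>. r < y} = \<sigma>"
    if "\<sigma> \<in> order_complex X" "r \<in> \<sigma>" for \<sigma>
    using that order_complex_comparable[OF that(1) that(2)] by (auto simp: less_le)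
  have inG: "{y \<in> \<sigma>. r < y} \<in> ?G" if "\<sigma> \<in> order_complex X" "card {y \<in> \<sigma>. r < y} = n" for \<sigma>
  proof -
    have "{y \<in> \<sigma>. r < y} \<in> order_complex X" using that(1) by (rule subset_order_complex) auto
    moreover have "\<sigma> \<subseteq> X" using that(1) by (simp add: order_complex_def)
    ultimately show ?thesis using that(2) by auto
  qed
  have e: "e \<in> simplicial_chains (order_complex X) (i + 1)"
    unfolding chains_order_complex_iff[OF X]
  proof (intro allI impI)
    fix \<sigma> assume "e \<sigma> \<noteq> 0"
    then have \<sigma>: "\<sigma> \<in> order_complex X" "r \<in> \<sigma>" "card {y \<in> \<sigma>. r < y} = n"
        "d {y \<in> \<sigma>. r < y} {y \<in> \<sigma>. y < r} \<noteq> 0"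
      by (auto simp: e_def split: if_splits)
    then have "int (card {y \<in> \<sigma>. y < r}) = i - int n + 1"
      using d(1)[OF inG] by (auto simp: simplicial_chains_def)
    moreover have "finite \<sigma>" using \<sigma>(1) by (simp add: order_complex_def)
    then have "card ({y \<in> \<sigma>. y < r} \<union> insert r {y \<in> \<sigma>. r < y}) = card {y \<in> \<sigma>. y < r} + Suc n"
      using \<sigma>(3) by (subst card_Un_disjoint) auto
    ultimately show "\<sigma> \<in> order_complex X \<and> int (card \<sigma>) = i + 1 + 1"
      using split[OF \<sigma>(1,2)] \<sigma>(1) by simp
  qed
  \<comment> \<open>Everything in \<open>\<alpha>\<close> is below \<open>r\<close> and everything
    in \<open>\<beta>\<close> above it, so a simplex \<open>\<alpha>\<close> below \<open>r\<close>
    always joins with \<open>insert r \<beta>\<close> to a simplex.\<close>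
  have slice_e: "slice ?A (insert r \<beta>) e = d \<beta>" if \<beta>: "\<beta> \<in> ?G" for \<beta>
  proof
    fix \<alpha>
    have chain_d: "\<alpha> \<in> order_complex ?A" if "d \<beta> \<alpha> \<noteq> 0"
      using that d(1)[OF \<beta>] by (auto simp: simplicial_chains_def)
    show "slice ?A (insert r \<beta>) e \<alpha> = d \<beta> \<alpha>"
    proof (cases "\<alpha> \<in> order_complex ?A")
      case True
      then have \<alpha>: "\<alpha> \<subseteq> ?A" by (simp add: order_complex_def)
      have "{y \<in> \<alpha> \<union> insert r \<beta>. r < y} = \<beta>" "{y \<in> \<alpha> \<union> insert r \<beta>. y < r} = \<alpha>"
        using \<alpha> \<beta> by auto
      moreover have "\<alpha> \<union> insert r \<beta> \<in> order_complex X"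
      proof -
        have "x \<le> y" if "x \<in> \<alpha>" "y \<in> insert r \<beta>" for x y
          using that \<alpha> \<beta> by (auto intro: less_imp_le less_trans)
        moreover have "r \<le> y" if "y \<in> \<beta>" for y using that \<beta> by auto
        ultimately show ?thesis
          using True \<beta> r by (auto simp: order_complex_def Complete_Partial_Order.chain_def)
      qed
      ultimately show ?thesis using \<alpha> \<beta> by (simp add: slice_def e_def)
    next
      case False
      have "e (\<alpha> \<union> insert r \<beta>) = 0" if "\<alpha> \<subseteq> ?A"
      proof -
        have "\<alpha> \<notin> order_complex X" using False that by (auto simp: order_complex_def)
        then have "\<alpha> \<union> insert r \<beta> \<notin> order_complex X" using subset_order_complex by blast
        then show ?thesis by (simp add: e_def)
      qed
      then show ?thesis using False chain_d by (auto simp: slice_def)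
    qed
  qed
  have be: "boundary_map e \<in> simplicial_chains (order_complex X) i"
    using boundary_map_chains[OF X e] by simp
  let ?c = "\<lambda>\<sigma>. c \<sigma> - boundary_map e \<sigma>"
  have bc: "boundary_map ?c = boundary_map c"
    using boundary_map_diff[OF X c be] boundary_map_boundary_map[OF X e] by simp
  \<comment> \<open>With exactly \<open>n\<close> vertices above \<open>r\<close>, the boundary of
    \<open>e\<close> reproduces \<open>c\<close> slice by slice; with more, both terms vanish. This
    lowers the bound from \<open>Suc n\<close> to \<open>n\<close>.\<close>
  have top: "?c \<sigma> = 0" if \<sigma>: "r \<in> \<sigma>" "n \<le> card {y \<in> \<sigma>. r < y}" for \<sigma>
  proof (cases "\<sigma> \<in> order_complex X")
    case False
    then have "c \<sigma> = 0" "boundary_map e \<sigma> = 0" using c be by (auto simp: simplicial_chains_def)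
    then show ?thesis by simp
  next
    case True
    then have fin: "finite \<sigma>" by (simp add: order_complex_def)
    show ?thesis
    proof (cases "n = card {y \<in> \<sigma>. r < y}")
      case n: True
      have \<beta>: "{y \<in> \<sigma>. r < y} \<in> ?G" using inG True n by simp
      have \<alpha>: "{y \<in> \<sigma>. y < r} \<subseteq> ?A" using True by (auto simp: order_complex_def)
      have "boundary_map e \<sigma> = boundary_map (slice ?A (insert r {y \<in> \<sigma>. r < y}) e) {y \<in> \<sigma>. y < r}"
        using boundary_map_slice[OF X r e, of n "{y \<in> \<sigma>. r < y}" "{y \<in> \<sigma>. y < r}"] \<alpha> \<beta>
          split[OF True \<sigma>(1)] by (auto simp: e_def)
      also have "\<dots> = slice ?A (insert r {y \<in> \<sigma>. r < y}) c {y \<in> \<sigma>. y < r}"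
        using slice_e[OF \<beta>] d(2)[OF \<beta>] by simp
      also have "\<dots> = c \<sigma>" using \<alpha> split[OF True \<sigma>(1)] by (simp add: slice_def)
      finally show ?thesis by simp
    next
      case False
      then have n: "n < card {y \<in> \<sigma>. r < y}" using \<sigma> by simp
      \<comment> \<open>Adding a vertex cannot decrease the number of vertices above
        \<open>r\<close>, and \<open>e\<close> lives where this number is exactly
        \<open>n\<close>.\<close>
      have "e (insert x \<sigma>) = 0" for x
      proof -
        have "card {y \<in> \<sigma>. r < y} \<le> card {y \<in> insert x \<sigma>. r < y}"
          using fin by (intro card_mono) auto
        then show ?thesis using n by (simp add: e_def)
      qed
      then have "boundary_map e \<sigma> = 0" by (simp add: boundary_map_eq[OF X e])
      then show ?thesis using vanish \<sigma>(1) n by simp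
    qed
  qed
  have "\<exists>e'\<in>simplicial_chains (order_complex X) (i + 1). \<forall>\<sigma>. r \<in> \<sigma> \<longrightarrow> ?c \<sigma> = boundary_map e' \<sigma>"
  proof (rule Suc.IH)
    show "?c \<in> simplicial_chains (order_complex X) i" using c be by (rule chains_diff)
    show "boundary_map ?c \<tau> = 0" if "r \<in> \<tau>" for \<tau> using that bc cyc by simp
  qed (rule top)
  then obtain e' where e': "e' \<in> simplicial_chains (order_complex X) (i + 1)"
      "\<And>\<sigma>. r \<in> \<sigma> \<Longrightarrow> ?c \<sigma> = boundary_map e' \<sigma>"
    by blast
  show ?case
  proof (intro bexI[of _ "\<lambda>\<sigma>. e \<sigma> + e' \<sigma>"] chains_add e e' allI impI)
    fix \<sigma> assume "r \<in> \<sigma>"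
    then show "c \<sigma> = boundary_map (\<lambda>\<sigma>. e \<sigma> + e' \<sigma>) \<sigma>"
      unfolding boundary_map_add[OF X e e'(1)] using e'(2)[of \<sigma>] by (simp add: algebra_simps)
  qed
qed

text \<open>Once \<open>c\<close> and the boundary of \<open>e\<close> agree on all simplices
  through \<open>r\<close>, their difference is supported off \<open>r\<close>.\<close>

lemma relative_cycle_remove_point:
  fixes c :: "'a::order set \<Rightarrow> 'k::field"
  assumes X: "finite X" and r: "r \<in> X"
    and acyclic: "\<And>j. (simplicial_cycles (order_complex {x \<in> X. x < r}) j :: ('a set \<Rightarrow> 'k) set)
      \<subseteq> simplicial_boundaries (order_complex {x \<in> X. x < r}) j"
    and c: "c \<in> simplicial_chains (order_complex X) i"
    and bc: "boundary_map c \<in> simplicial_chains (order_complex (X - {r})) (i - 1)"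
  shows "\<exists>e\<in>simplicial_chains (order_complex X) (i + 1).
    (\<lambda>\<sigma>. c \<sigma> - boundary_map e \<sigma>) \<in> simplicial_chains (order_complex (X - {r})) i"
proof -
  have "boundary_map c \<tau> = 0" if "r \<in> \<tau>" for \<tau>
    using that bc by (auto simp: simplicial_chains_def order_complex_def)
  \<comment> \<open>The starting bound of the descent: a simplex has at most \<open>card X\<close>
    vertices.\<close>
  moreover have "c \<sigma> = 0" if "Suc (card X) \<le> card {y \<in> \<sigma>. r < y}" for \<sigma>
  proof (rule ccontr)
    assume "c \<sigma> \<noteq> 0"
    then have "\<sigma> \<subseteq> X" using c by (auto simp: simplicial_chains_def order_complex_def)
    then have "card {y \<in> \<sigma>. r < y} \<le> card X" using X by (intro card_mono) auto
    then show False using that by simp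
  qed
  ultimately obtain e where e: "e \<in> simplicial_chains (order_complex X) (i + 1)"
      "\<And>\<sigma>. r \<in> \<sigma> \<Longrightarrow> c \<sigma> = boundary_map e \<sigma>"
    using relative_cycle_remove_point_aux[OF X r acyclic c] by metis
  have ch: "(\<lambda>\<sigma>. c \<sigma> - boundary_map e \<sigma>) \<in> simplicial_chains (order_complex X) i"
    using boundary_map_chains[OF X e(1)] c by (intro chains_diff) simp_all
  have "\<sigma> \<subseteq> X - {r}" if "c \<sigma> - boundary_map e \<sigma> \<noteq> 0" for \<sigma>
  proof -
    have "\<sigma> \<in> order_complex X" using ch that by (auto simp: simplicial_chains_def)
    moreover have "r \<notin> \<sigma>" using that e(2) by auto
    ultimately show ?thesis by (auto simp: order_complex_def)
  qed
  then show ?thesis using e(1) chains_restrict[OF ch] by blast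
qed

text \<open>The points of \<open>X - Y\<close> are removed by induction on their number. Each
  correction by a boundary leaves the boundary of the chain unchanged, so it still lies in
  \<open>Y\<close> at the next step.\<close>

lemma relative_cycle_boundary:
  fixes c :: "'a::order set \<Rightarrow> 'k::field"
  assumes "finite X" "Y \<subseteq> X"
    and "\<And>r j. r \<in> X - Y \<Longrightarrow>
      (simplicial_cycles (order_complex {x \<in> X. x < r}) j :: ('a set \<Rightarrow> 'k) set)
      \<subseteq> simplicial_boundaries (order_complex {x \<in> X. x < r}) j"
    and "c \<in> simplicial_chains (order_complex X) i"
    and "boundary_map c \<in> simplicial_chains (order_complex Y) (i - 1)"
  shows "\<exists>e\<in>simplicial_chains (order_complex X) (i + 1).
    (\<lambda>\<sigma>. c \<sigma> - boundary_map e \<sigma>) \<in> simplicial_chains (order_complex Y) i"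
  using assms
proof (induction "card (X - Y)" arbitrary: X c)
  case 0
  then have "X = Y" by auto
  then show ?case using 0 by (intro bexI[of _ "\<lambda>_. 0"]) (auto simp: boundary_map_zero)
next
  case (Suc n)
  note X = Suc.prems(1) and YX = Suc.prems(2) and acyclic = Suc.prems(3) and c = Suc.prems(4)
    and bc = Suc.prems(5)
  have "finite (X - Y)" "X - Y \<noteq> {}" using X Suc.hyps(2) by (simp, metis card.empty nat.distinct(2))
  \<comment> \<open>A maximal \<open>r\<close> lies below no other point still to be removed, so the
    lower sets of those points, and with them the acyclicity assumption, survive its
    removal.\<close>
  then obtain r where r: "r \<in> X - Y" "\<And>s. s \<in> X - Y \<Longrightarrow> \<not> r < s"
    by (metis finite_has_maximal less_le)
  let ?X = "X - {r}"
  have Y: "Y \<subseteq> ?X" using YX r by auto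
  obtain e where e: "e \<in> simplicial_chains (order_complex X) (i + 1)"
      "(\<lambda>\<sigma>. c \<sigma> - boundary_map e \<sigma>) \<in> simplicial_chains (order_complex ?X) i"
    using relative_cycle_remove_point[OF X _ acyclic c, of r]
      bc chains_mono[OF order_complex_mono[OF Y]] r(1) by blast
  have be: "boundary_map e \<in> simplicial_chains (order_complex X) i"
    using boundary_map_chains[OF X e(1)] by simp
  have "boundary_map (\<lambda>\<sigma>. c \<sigma> - boundary_map e \<sigma>) = boundary_map c"
    using boundary_map_diff[OF X c be] boundary_map_boundary_map[OF X e(1)] by simp
  moreover have "n = card (?X - Y)"
  proof -
    have "?X - Y = (X - Y) - {r}" by auto
    then show ?thesis using Suc.hyps(2) r(1) \<open>finite (X - Y)\<close> by simp
  qed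
  moreover have "{x \<in> ?X. x < s} = {x \<in> X. x < s}" if "s \<in> ?X - Y" for s
    using r(2)[of s] that by auto
  ultimately obtain e' where e': "e' \<in> simplicial_chains (order_complex ?X) (i + 1)"
      "(\<lambda>\<sigma>. c \<sigma> - boundary_map e \<sigma> - boundary_map e' \<sigma>) \<in> simplicial_chains (order_complex Y) i"
    using Suc.hyps(1)[of ?X "\<lambda>\<sigma>. c \<sigma> - boundary_map e \<sigma>"] X Y e(2) bc acyclic by auto
  have e'X: "e' \<in> simplicial_chains (order_complex X) (i + 1)"
    using e'(1) chains_mono[OF order_complex_mono, of ?X X] by blast
  show ?case
    using chains_add[OF e(1) e'X] e'(2)
    by (intro bexI[of _ "\<lambda>\<sigma>. e \<sigma> + e' \<sigma>"])
      (simp_all add: boundary_map_add[OF X e(1) e'X] diff_diff_eq)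
qed

section \<open>Reduced homology\<close>

text \<open>The operations of \<open>chain_module\<close> are pointwise and independent of the
  complex and the degree, so one closure condition serves for every carrier.\<close>

definition function_subspace :: "('b \<Rightarrow> 'k::field) set \<Rightarrow> bool" where
  "function_subspace S \<longleftrightarrow> (\<lambda>_. 0) \<in> S \<and> (\<forall>c\<in>S. \<forall>d\<in>S. (\<lambda>\<sigma>. c \<sigma> + d \<sigma>) \<in> S)
    \<and> (\<forall>a. \<forall>c\<in>S. (\<lambda>\<sigma>. a * c \<sigma>) \<in> S)"

lemma vectorspace_chain_module:
  fixes S :: "('a set \<Rightarrow> 'k::field) set"
  assumes S: "function_subspace S"
  shows "vectorspace class_ring ((chain_module K i)\<lparr>carrier := S\<rparr>)"
proof -
  have "abelian_group ((chain_module K i)\<lparr>carrier := S\<rparr>)"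
  proof (rule abelian_groupI)
    fix c assume "c \<in> carrier ((chain_module K i)\<lparr>carrier := S\<rparr>)"
    then have "c \<in> S" by simp
    then have "(\<lambda>\<sigma>. -1 * c \<sigma>) \<in> S"
      using S unfolding function_subspace_def by blast
    then show "\<exists>d\<in>carrier ((chain_module K i)\<lparr>carrier := S\<rparr>).
        d \<oplus>\<^bsub>(chain_module K i)\<lparr>carrier := S\<rparr>\<^esub> c = \<zero>\<^bsub>(chain_module K i)\<lparr>carrier := S\<rparr>\<^esub>"
      by (intro bexI[of _ "\<lambda>\<sigma>. -1 * c \<sigma>"]) (simp_all add: chain_module_def)
  qed (use S in \<open>simp_all add: function_subspace_def chain_module_def algebra_simps\<close>)
  then have "module class_ring ((chain_module K i)\<lparr>carrier := S\<rparr>)"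
    using S by (intro moduleI class_cring.cring_axioms)
      (simp_all add: function_subspace_def chain_module_def algebra_simps)
  then show ?thesis by (intro vectorspace.intro class_field)
qed

text \<open>The ambient carrier \<open>T\<close> is arbitrary because homology is a quotient of the
  cycles rather than of all chains.\<close>

lemma subspace_chain_module:
  fixes S T :: "('a set \<Rightarrow> 'k::field) set"
  assumes "function_subspace S" "function_subspace T" "S \<subseteq> T"
  shows "VectorSpace.subspace class_ring S ((chain_module K i)\<lparr>carrier := T\<rparr>)"
proof -
  interpret T: vectorspace class_ring "(chain_module K i)\<lparr>carrier := T\<rparr>"
    using assms(2) by (rule vectorspace_chain_module)
  show ?thesis
    using assms
    by (intro subspace.intro LinearCombinations.submodule.intro T.vectorspace_axioms T.module_axioms)
      (simp_all add: function_subspace_def chain_module_def)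
qed

lemma function_subspace_cycles:
  assumes "finite X"
  shows "function_subspace (simplicial_cycles (order_complex X) i :: ('a::order set \<Rightarrow> 'k::field) set)"
  unfolding function_subspace_def simplicial_cycles_def
  by (auto simp: chains_add chains_smult boundary_map_zero boundary_map_add[OF assms]
      boundary_map_smult[OF assms])

lemma function_subspace_boundaries:
  assumes "finite X"
  shows "function_subspace (simplicial_boundaries (order_complex X) i :: ('a::order set \<Rightarrow> 'k::field) set)"
  unfolding function_subspace_def simplicial_boundaries_def
proof (intro conjI ballI allI)
  show "(\<lambda>_. 0) \<in> boundary_map ` simplicial_chains (order_complex X) (i + 1)"
    by (rule image_eqI[OF _ chains_zero]) (simp add: boundary_map_zero)
qed (auto simp: boundary_map_add[OF assms, symmetric] boundary_map_smult[OF assms, symmetric]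
    intro!: imageI chains_add chains_smult)

lemma boundaries_subset_cycles:
  assumes "finite X"
  shows "simplicial_boundaries (order_complex X) i
    \<subseteq> (simplicial_cycles (order_complex X) i :: ('a::order set \<Rightarrow> 'k::field) set)"
  using boundary_map_chains[OF assms, of _ "i + 1"] boundary_map_boundary_map[OF assms, of _ "i + 1"]
  by (auto simp: simplicial_boundaries_def simplicial_cycles_def)

lemma mem_rcos_chain_module:
  "d \<in> S +>\<^bsub>(chain_module K i)\<lparr>carrier := T\<rparr>\<^esub> c \<longleftrightarrow> (\<exists>b\<in>S. d = (\<lambda>\<sigma>. b \<sigma> + c \<sigma>))"
  by (auto simp: a_r_coset_def' chain_module_def)

text \<open>If the coset of a cycle is the zero coset, which is the set of boundaries itself, then
  the cycle, being a member of its own coset, is a boundary.\<close>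

lemma trivial_homology_imp_cycles_subset_boundaries:
  assumes "finite X"
    and trivial: "carrier (reduced_homology (order_complex X) i :: ('k::field, ('a::order set \<Rightarrow> 'k) set) module)
      = {\<zero>\<^bsub>reduced_homology (order_complex X) i\<^esub>}"
  shows "(simplicial_cycles (order_complex X) i :: ('a set \<Rightarrow> 'k) set)
    \<subseteq> simplicial_boundaries (order_complex X) i"
proof
  let ?B = "simplicial_boundaries (order_complex X) i :: ('a set \<Rightarrow> 'k) set"
  let ?Z = "simplicial_cycles (order_complex X) i :: ('a set \<Rightarrow> 'k) set"
  let ?V = "(chain_module (order_complex X) i)\<lparr>carrier := ?Z\<rparr>"
  fix c assume "c \<in> ?Z"
  then have "?B +>\<^bsub>?V\<^esub> c \<in> carrier (quotient_module ?V ?B)"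
    unfolding carrier_quotient_module by (intro imageI) simp
  then have "?B +>\<^bsub>?V\<^esub> c = ?B"
    using trivial by (simp add: reduced_homology_def quotient_module_def)
  moreover have "c \<in> ?B +>\<^bsub>?V\<^esub> c"
    using function_subspace_boundaries[OF assms(1)] unfolding mem_rcos_chain_module function_subspace_def
    by (intro bexI[of _ "\<lambda>_. 0"]) auto
  ultimately show "c \<in> ?B" by simp
qed

section \<open>Comparing the homology of a poset and a subset\<close>

text \<open>The second isomorphism theorem applied to the cycles of \<open>X\<close>, with the
  cycles of \<open>Y\<close> as \<open>U\<close> and the boundaries of \<open>X\<close> as
  \<open>W\<close>. Vanishing relative homology in degree \<open>i\<close> gives the sum condition,
  in degree \<open>i + 1\<close> the intersection.\<close>

lemma reduced_homology_isomorphic: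
  assumes X: "finite X" and Y: "Y \<subseteq> X"
    and acyclic: "\<And>r j. r \<in> X - Y \<Longrightarrow>
      (simplicial_cycles (order_complex {x \<in> X. x < r}) j :: ('a::order set \<Rightarrow> 'k::field) set)
      \<subseteq> simplicial_boundaries (order_complex {x \<in> X. x < r}) j"
  shows "vectorspace_isomorphic (class_ring :: 'k ring)
    (reduced_homology (order_complex X) i) (reduced_homology (order_complex Y) i)"
proof -
  note rel = relative_cycle_boundary[OF X Y acyclic]
  have fY: "finite Y" using Y X by (rule finite_subset)
  have mono: "simplicial_chains (order_complex Y) j \<subseteq> simplicial_chains (order_complex X) j" for j
    by (intro chains_mono order_complex_mono Y)
  let ?Z = "\<lambda>X. simplicial_cycles (order_complex X) i :: ('a set \<Rightarrow> 'k) set"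
  let ?B = "\<lambda>X. simplicial_boundaries (order_complex X) i :: ('a set \<Rightarrow> 'k) set"
  let ?V = "\<lambda>X. (chain_module (order_complex X) i)\<lparr>carrier := ?Z X\<rparr>"
  have ZZ: "?Z Y \<subseteq> ?Z X" using mono by (auto simp: simplicial_cycles_def)
  have eq: "?Z Y \<inter> ?B X = ?B Y"
  proof
    show "?B Y \<subseteq> ?Z Y \<inter> ?B X"
      using boundaries_subset_cycles[OF fY] image_mono[OF mono, of boundary_map "i + 1"]
      by (intro Int_greatest) (simp_all only: simplicial_boundaries_def)
    show "?Z Y \<inter> ?B X \<subseteq> ?B Y"
    proof
      fix c assume "c \<in> ?Z Y \<inter> ?B X"
      then obtain d where d: "d \<in> simplicial_chains (order_complex X) (i + 1)" "c = boundary_map d"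
          and c: "c \<in> simplicial_chains (order_complex Y) i"
        by (auto simp: simplicial_boundaries_def simplicial_cycles_def)
      \<comment> \<open>Here \<open>d\<close> is a relative cycle, as its boundary \<open>c\<close>
        lies in \<open>Y\<close>; pushing it into \<open>Y\<close> keeps that boundary.\<close>
      then obtain e where e: "e \<in> simplicial_chains (order_complex X) (i + 1 + 1)"
          "(\<lambda>\<sigma>. d \<sigma> - boundary_map e \<sigma>) \<in> simplicial_chains (order_complex Y) (i + 1)"
        using rel[of d "i + 1"] by auto
      have "boundary_map e \<in> simplicial_chains (order_complex X) (i + 1)"
        using boundary_map_chains[OF X e(1)] by (simp only: add_diff_cancel_right')
      then have "boundary_map (\<lambda>\<sigma>. d \<sigma> - boundary_map e \<sigma>) = c"
        using boundary_map_diff[OF X d(1)] boundary_map_boundary_map[OF X e(1)] d(2) by simp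
      then show "c \<in> ?B Y" using e(2) by (auto simp: simplicial_boundaries_def)
    qed
  qed
  \<comment> \<open>The two modules can differ only in their carriers.\<close>
  have VY: "(?V X)\<lparr>carrier := ?Z Y\<rparr> = ?V Y" by (simp add: chain_module_def)
  have "vectorspace_isomorphic class_ring (quotient_module (?V X) (?B X))
      (quotient_module ((?V X)\<lparr>carrier := ?Z Y\<rparr>) (?Z Y \<inter> ?B X))"
  proof (rule vectorspace_isomorphic_quotient_subspace)
    show "VectorSpace.subspace class_ring (?B X) (?V X)"
      by (intro subspace_chain_module function_subspace_boundaries function_subspace_cycles
          boundaries_subset_cycles X)
    show "VectorSpace.subspace class_ring (?Z Y) (?V X)"
      by (intro subspace_chain_module function_subspace_cycles X fY ZZ)
    show "VectorSpace.subspace class_ring (?Z Y \<inter> ?B X) ((?V X)\<lparr>carrier := ?Z Y\<rparr>)"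
      unfolding VY eq
      by (intro subspace_chain_module function_subspace_boundaries function_subspace_cycles
          boundaries_subset_cycles fY)
    fix c assume "c \<in> carrier (?V X)"
    then have c: "c \<in> simplicial_chains (order_complex X) i" "boundary_map c = (\<lambda>_. 0)"
      by (auto simp: simplicial_cycles_def)
    \<comment> \<open>The boundary of the cycle \<open>c\<close> is zero, which is a chain of
      \<open>Y\<close>.\<close>
    then obtain e where e: "e \<in> simplicial_chains (order_complex X) (i + 1)"
        "(\<lambda>\<sigma>. c \<sigma> - boundary_map e \<sigma>) \<in> simplicial_chains (order_complex Y) i"
      using rel[of c i] by auto
    have "boundary_map e \<in> simplicial_chains (order_complex X) i"
      using boundary_map_chains[OF X e(1)] by simp
    then have "boundary_map (\<lambda>\<sigma>. c \<sigma> - boundary_map e \<sigma>) = (\<lambda>_. 0)"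
      using boundary_map_diff[OF X c(1)] boundary_map_boundary_map[OF X e(1)] c(2) by simp
    then have "(\<lambda>\<sigma>. c \<sigma> - boundary_map e \<sigma>) \<in> ?Z Y"
      using e(2) by (simp add: simplicial_cycles_def)
    \<comment> \<open>Membership in the coset asks for a boundary to be added to \<open>c\<close>,
      hence the factor \<open>-1\<close>.\<close>
    moreover have "(\<lambda>\<sigma>. - 1 * boundary_map e \<sigma>) \<in> ?B X"
      using function_subspace_boundaries[OF X] imageI[OF e(1), of boundary_map]
      unfolding function_subspace_def simplicial_boundaries_def by blast
    then have "(\<lambda>\<sigma>. c \<sigma> - boundary_map e \<sigma>) \<in> ?B X +>\<^bsub>?V X\<^esub> c"
      unfolding mem_rcos_chain_module by (rule bexI[rotated]) simp
    ultimately show "\<exists>u\<in>?Z Y. u \<in> ?B X +>\<^bsub>?V X\<^esub> c" by blast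
  qed
  then show ?thesis unfolding VY eq reduced_homology_def .
qed

section \<open>Intervals in a poset and in its Betti poset\<close>

theorem theorem1p4:
  fixes P :: "'a::order set" and z q :: 'a and i :: int
  assumes "finite P"
    and "unique_minimal P z"
    and "q \<in> betti_poset TYPE('k::field) P z"
  shows "vectorspace_isomorphic (class_ring :: 'k ring)
           (reduced_homology (interval_complex P z q) i)
           (reduced_homology (interval_complex (betti_poset TYPE('k) P z) z q) i)"
  unfolding interval_complex_def
proof (rule reduced_homology_isomorphic)
  let ?X = "{x \<in> P. z < x \<and> x < q}"
  let ?Y = "{x \<in> betti_poset TYPE('k) P z. z < x \<and> x < q}"
  show "finite ?X" using assms(1) by simp
  show "?Y \<subseteq> ?X" by (auto simp: betti_poset_def)
  fix r j assume r: "r \<in> ?X - ?Y"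
  \<comment> \<open>Because \<open>r < q\<close>, the points of the interval below \<open>r\<close>
    form the full open interval from \<open>z\<close> to \<open>r\<close> in \<open>P\<close>, whose
    homology decides whether \<open>r\<close> is a Betti element.\<close>
  then have lower: "{x \<in> ?X. x < r} = {x \<in> P. z < x \<and> x < r}" by auto
  have "carrier (reduced_homology (interval_complex P z r) j :: ('k, ('a set \<Rightarrow> 'k) set) module)
      = {\<zero>\<^bsub>reduced_homology (interval_complex P z r) j\<^esub>}"
    using r by (auto simp: betti_poset_def Let_def)
  then show "(simplicial_cycles (order_complex {x \<in> ?X. x < r}) j :: ('a set \<Rightarrow> 'k) set)
      \<subseteq> simplicial_boundaries (order_complex {x \<in> ?X. x < r}) j"
    unfolding lower using assms(1)
    by (intro trivial_homology_imp_cycles_subset_boundaries) (simp_all add: interval_complex_def)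
qed

end
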